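(* Let $\diamond$ be a monotonic generalized convolution on $\mathcal{P}_+$, let $\nu\in\mathcal{P}_+$, let $\{N(t):t\ge 0\}$ be the $\diamond$-renewal process with unit step distribution $\nu$, and let $R(t)=\mathbf{E}N(t)$ be its renewal function. Then $R$ is the cumulative distribution function of a non-negative measure $m$ on $[0,\infty)$, i.e. $m([0,t])=R(t)$ for all $t\ge 0$, and $$m=\nu+\nu\diamond m .$$
   Context: $\mathcal{P}_+$ is the set of Borel probability measures on $[0,\infty)$; $\mathbf{T}_a\lambda$ denotes the law of $aX$ when $X$ has law $\lambda$; $\Rightarrow$ is weak convergence. A generalized convolution is a commutative, associative binary operation $\diamond$ on $\mathcal{P}_+$ such that: (i) $\lambda\diamond\delta_0=\lambda$; (ii) $(p\lambda_1+(1-p)\lambda_2)\diamond\lambda=p(\lambda_1\diamond\lambda)+(1-p)(\lambda_2\diamond\lambda)$ for $p\in[0,1]$; (iii) $\mathbf{T}_a(\lambda_1\diamond\lambda_2)=(\mathbf{T}_a\lambda_1)\diamond(\mathbf{T}_a\lambda_2)$ for $a\ge 0$; (iv) if $\lambda_n\Rightarrow\lambda$ and $\nu_n\Rightarrow\nu$ then $\lambda_n\diamond\nu_n\Rightarrow\lambda\diamond\nu$; (v) there are $c_n>0$ such that $\mathbf{T}_{c_n}\delta_1^{\diamond n}$ converges weakly to some measure different from $\delta_0$. Here $\lambda^{\diamond n}=\lambda\diamond\cdots\diamond\lambda$ ($n$ factors). One has $(\lambda_1\diamond\lambda_2)(A)=\int\int(\delta_x\diamond\delta_y)(A)\,\lambda_1(dx)\,\lambda_2(dy)$,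 and for a non-negative (not necessarily finite) measure $m$ on $[0,\infty)$ which is a countable sum of probability measures, $\nu\diamond m$ is defined by the same formula, $(\nu\diamond m)(A)=\int\int(\delta_x\diamond\delta_y)(A)\,\nu(dx)\,m(dy)$. $\diamond$ is monotonic if $(\delta_x\diamond\delta_y)([\max\{x,y\},\infty))=1$ for all $x,y\ge0$. The generalized random walk with step distribution $\nu$ is the Markov process $(S_n)_{n\ge1}$ with $\mathcal{L}(S_1)=\nu$ and transition probabilities $P(S_n\in\cdot\mid S_k=x)=\delta_x\diamond\nu^{\diamond(n-k)}$ for $k<n$. The $\diamond$-renewal process is $N(t)=\inf\{n\ge 0:S_{n+1}>t\}$, with $N(t)=\infty$ if no such $n$ exists. The value $R(t)=\infty$ is allowed. *)

theory Defs
  imports "HOL-Probability.Probability"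
begin

text \<open>Measures on the half-line are represented as Borel measures on the reals that do not
  charge the negative half-line.\<close>

definition half_line_measure :: "real measure \<Rightarrow> bool" where
  "half_line_measure m \<longleftrightarrow> sets m = sets borel \<and> emeasure m {..<0} = 0"

definition P_plus :: "real measure set" where
  "P_plus = {l. prob_space l \<and> half_line_measure l}"

abbreviation dirac :: "real \<Rightarrow> real measure" ("\<delta>") where
  "\<delta> x \<equiv> return borel x"

definition dilate :: "real \<Rightarrow> real measure \<Rightarrow> real measure" where
  "dilate a l = distr l borel (\<lambda>x. a * x)"

definition add_measure :: "'a measure \<Rightarrow> 'a measure \<Rightarrow> 'a measure" where
  "add_measure M N = measure_of (space M) (sets M) (\<lambda>A. emeasure M A + emeasure N A)"

lemma emeasure_add_measure:
  assumes "sets N = sets M" "A \<in> sets M"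
  shows "emeasure (add_measure M N) A = emeasure M A + emeasure N A"
  unfolding add_measure_def
proof (rule emeasure_measure_of_sigma)
  show "countably_additive (sets M) (\<lambda>A. emeasure M A + emeasure N A)"
    using assms(1)
    by (auto simp: countably_additive_def suminf_add[symmetric] suminf_emeasure)
qed (use assms in \<open>auto simp: positive_def sets.sigma_algebra_axioms\<close>)

definition mixture :: "real \<Rightarrow> 'a measure \<Rightarrow> 'a measure \<Rightarrow> 'a measure" where
  "mixture p M N = add_measure (scale_measure (ennreal p) M) (scale_measure (ennreal (1 - p)) N)"

text \<open>The zeroth power is \<open>\<delta> 0\<close>, the neutral element of a generalized convolution.\<close>

primrec conv_power ::
  "(real measure \<Rightarrow> real measure \<Rightarrow> real measure) \<Rightarrow> real measure \<Rightarrow> nat \<Rightarrow> real measure" where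
  "conv_power gc l 0 = \<delta> 0"
| "conv_power gc l (Suc n) = gc (conv_power gc l n) l"

locale generalized_convolution =
  fixes gc :: "real measure \<Rightarrow> real measure \<Rightarrow> real measure" (infixl "\<diamondop>" 70)
  assumes closed: "l1 \<in> P_plus \<Longrightarrow> l2 \<in> P_plus \<Longrightarrow> l1 \<diamondop> l2 \<in> P_plus"
    and commute: "l1 \<in> P_plus \<Longrightarrow> l2 \<in> P_plus \<Longrightarrow> l1 \<diamondop> l2 = l2 \<diamondop> l1"
    and assoc: "l1 \<in> P_plus \<Longrightarrow> l2 \<in> P_plus \<Longrightarrow> l3 \<in> P_plus \<Longrightarrow>
      (l1 \<diamondop> l2) \<diamondop> l3 = l1 \<diamondop> (l2 \<diamondop> l3)"
    and neutral: "l \<in> P_plus \<Longrightarrow> l \<diamondop> \<delta> 0 = l"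
    and mixture: "l1 \<in> P_plus \<Longrightarrow> l2 \<in> P_plus \<Longrightarrow> l \<in> P_plus \<Longrightarrow> 0 \<le> p \<Longrightarrow> p \<le> 1 \<Longrightarrow>
      mixture p l1 l2 \<diamondop> l = mixture p (l1 \<diamondop> l) (l2 \<diamondop> l)"
    and dilate: "l1 \<in> P_plus \<Longrightarrow> l2 \<in> P_plus \<Longrightarrow> 0 \<le> a \<Longrightarrow>
      dilate a (l1 \<diamondop> l2) = dilate a l1 \<diamondop> dilate a l2"
    and weakly_continuous: "(\<And>n. ls n \<in> P_plus) \<Longrightarrow> (\<And>n. ns n \<in> P_plus) \<Longrightarrow>
      l \<in> P_plus \<Longrightarrow> v \<in> P_plus \<Longrightarrow> weak_conv_m ls l \<Longrightarrow> weak_conv_m ns v \<Longrightarrow>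
      weak_conv_m (\<lambda>n. ls n \<diamondop> ns n) (l \<diamondop> v)"
    and normalizable: "\<exists>c l. (\<forall>n. 0 < c n) \<and> l \<in> P_plus \<and> l \<noteq> \<delta> 0 \<and>
      weak_conv_m (\<lambda>n. dilate (c n) (conv_power (\<diamondop>) (\<delta> 1) n)) l"

locale monotonic_generalized_convolution = generalized_convolution +
  assumes monotonic: "0 \<le> x \<Longrightarrow> 0 \<le> y \<Longrightarrow> measure (\<delta> x \<diamondop> \<delta> y) {max x y..} = 1"

definition countable_sum_of_prob :: "real measure \<Rightarrow> bool" where
  "countable_sum_of_prob m \<longleftrightarrow> sets m = sets borel \<and>
    (\<exists>(I :: nat set) \<kappa>. (\<forall>i\<in>I. \<kappa> i \<in> P_plus) \<and>
      (\<forall>A\<in>sets borel. emeasure m A = (\<integral>\<^sup>+i. emeasure (\<kappa> i) A \<partial>count_space I)))"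

text \<open>The extension of the convolution to a second argument that need not be finite.\<close>

definition conv_ext ::
  "(real measure \<Rightarrow> real measure \<Rightarrow> real measure) \<Rightarrow> real measure \<Rightarrow> real measure \<Rightarrow> real measure"
  where
  "conv_ext gc \<nu> m = measure_of UNIV (sets borel)
    (\<lambda>A. \<integral>\<^sup>+y\<in>{0..}. (\<integral>\<^sup>+x\<in>{0..}. emeasure (gc (\<delta> x) (\<delta> y)) A \<partial>\<nu>) \<partial>m)"

definition history :: "'a measure \<Rightarrow> (nat \<Rightarrow> 'a \<Rightarrow> real) \<Rightarrow> nat \<Rightarrow> 'a measure" where
  "history M S k = sigma (space M) (\<Union>i\<in>{1..k}. {S i -` A \<inter> space M | A. A \<in> sets borel})"

text \<open>The last conjunct is the Markov property together with the transition law: conditionally on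
  \<open>S 1, \<dots>, S k\<close>, the law of \<open>S n\<close> is the convolution of \<open>\<delta> (S k)\<close> with the power \<open>n - k\<close> of the
  step distribution.  The index set is \<open>{1..}\<close>; \<open>S 0\<close> plays no role.\<close>

definition generalized_random_walk ::
  "(real measure \<Rightarrow> real measure \<Rightarrow> real measure) \<Rightarrow> real measure \<Rightarrow>
    'a measure \<Rightarrow> (nat \<Rightarrow> 'a \<Rightarrow> real) \<Rightarrow> bool" where
  "generalized_random_walk gc \<nu> M S \<longleftrightarrow>
    prob_space M \<and>
    (\<forall>n\<ge>1. S n \<in> borel_measurable M \<and> (\<forall>\<omega>\<in>space M. 0 \<le> S n \<omega>)) \<and>
    distr M borel (S 1) = \<nu> \<and>
    (\<forall>k n A. 1 \<le> k \<longrightarrow> k < n \<longrightarrow> A \<in> sets borel \<longrightarrow>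
      (AE \<omega> in M. real_cond_exp M (history M S k) (\<lambda>\<omega>. indicator A (S n \<omega>)) \<omega> =
        measure (gc (\<delta> (S k \<omega>)) (conv_power gc \<nu> (n - k))) A))"

text \<open>In the extended naturals \<open>Inf {} = \<infinity>\<close>.\<close>

definition renewal_process :: "(nat \<Rightarrow> 'a \<Rightarrow> real) \<Rightarrow> real \<Rightarrow> 'a \<Rightarrow> enat" where
  "renewal_process S t \<omega> = Inf {enat n | n. S (Suc n) \<omega> > t}"

definition renewal_function :: "'a measure \<Rightarrow> (nat \<Rightarrow> 'a \<Rightarrow> real) \<Rightarrow> real \<Rightarrow> ennreal" where
  "renewal_function M S t = (\<integral>\<^sup>+\<omega>. ennreal_of_enat (renewal_process S t \<omega>) \<partial>M)"

end

theory Submission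
  imports Defs
begin

text \<open>The measure \<open>m\<close> is \<open>\<Sum>n\<ge>1. \<nu>\<^sup>n\<close>, the powers being convolution powers.  Monotonicity makes the paths of
  the walk nondecreasing almost surely, so \<open>N(t)\<close> is the number of \<open>n \<ge> 1\<close> with \<open>S n \<le> t\<close>, and \<open>S n\<close>
  has law \<open>\<nu>\<^sup>n\<close>; integrating gives \<open>R(t) = m [0, t]\<close>.  Shifting the summation index gives the renewal
  equation.

  Both the law of \<open>S n\<close> and the renewal equation need the fact that \<open>l \<diamond> \<mu>\<close> is the \<open>l\<close>-mixture of the
  measures \<open>\<delta> x \<diamond> \<mu>\<close>, which is not among the axioms.  For finitely supported \<open>l\<close> it follows
  from the mixture axiom by splitting off one atom at a time; in general \<open>l\<close> is a weak limit of such
  measures and the convolution is weakly continuous.\<close>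

section \<open>Real distributions and cut-off functions\<close>

lemma cts_step_nonneg: "0 \<le> cts_step a b x"
  by (simp add: cts_step_def)

lemma cts_step_le_1: "cts_step a b x \<le> 1"
  by (simp add: cts_step_def)

lemma norm_cts_step_le_1: "norm (cts_step a b x) \<le> 1"
  using cts_step_nonneg[of a b x] cts_step_le_1[of a b x] by simp

lemma isCont_cts_step: "a < b \<Longrightarrow> isCont (cts_step a b) x"
  using uniformly_continuous_imp_continuous[OF cts_step_uniformly_continuous, of a b]
  by (simp add: continuous_on_eq_continuous_at)

text \<open>The ramp lies between the indicators of \<open>{..a}\<close> and of
  \<open>{..a + 1/(n+1)}\<close>, so its expectation is squeezed between two values of the
  distribution function; right-continuity makes these merge.\<close>

lemma (in real_distribution) cts_step_tendsto_cdf: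
  "(\<lambda>n. expectation (cts_step a (a + inverse (real (Suc n))))) \<longlonglongrightarrow> cdf M a"
proof (rule tendsto_sandwich)
  show "\<forall>\<^sub>F n in sequentially. cdf M a \<le> expectation (cts_step a (a + inverse (real (Suc n))))"
    by (intro always_eventually allI cdf_cts_step) simp
  show "\<forall>\<^sub>F n in sequentially. expectation (cts_step a (a + inverse (real (Suc n))))
      \<le> cdf M (a + inverse (real (Suc n)))"
    by (intro always_eventually allI cdf_cts_step) simp
  have "filterlim (\<lambda>n. a + inverse (real (Suc n))) (at_right a) sequentially"
    unfolding filterlim_at
    using tendsto_add[OF tendsto_const LIMSEQ_inverse_real_of_nat, of a]
    by (auto intro!: always_eventually)
  then show "(\<lambda>n. cdf M (a + inverse (real (Suc n)))) \<longlonglongrightarrow> cdf M a"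
    using cdf_is_right_cont unfolding continuous_within
    by (rule filterlim_compose[rotated])
qed auto

text \<open>Ramp integrals determine the distribution function in the limit. The ramps are bounded
  and continuous, so they are test functions that can be passed through weak limits.\<close>

lemma real_distribution_eqI_cts_step:
  assumes M: "real_distribution M" and N: "real_distribution N"
    and eq: "\<And>a b. a < b \<Longrightarrow> integral\<^sup>L M (cts_step a b) = integral\<^sup>L N (cts_step a b)"
  shows "M = N"
proof (rule cdf_unique[OF M N], rule ext)
  fix a
  show "cdf M a = cdf N a"
    using real_distribution.cts_step_tendsto_cdf[OF M, of a]
      real_distribution.cts_step_tendsto_cdf[OF N, of a]
    by (simp add: eq LIMSEQ_unique)
qed

section \<open>Probability measures on the half-line\<close>

lemma P_plus_real_distribution: "l \<in> P_plus \<Longrightarrow> real_distribution l"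
  by (simp add: P_plus_def half_line_measure_def real_distribution_def
      real_distribution_axioms_def)

lemma P_plus_prob_space: "l \<in> P_plus \<Longrightarrow> prob_space l"
  by (simp add: P_plus_def)

lemma P_plus_sets: "l \<in> P_plus \<Longrightarrow> sets l = sets borel"
  by (simp add: P_plus_def half_line_measure_def)

lemma P_plus_space: "l \<in> P_plus \<Longrightarrow> space l = UNIV"
  using sets_eq_imp_space_eq[OF P_plus_sets] by simp

lemma P_plus_emeasure_neg: "l \<in> P_plus \<Longrightarrow> emeasure l {..<0} = 0"
  by (simp add: P_plus_def half_line_measure_def)

lemma P_plus_AE_nonneg: "l \<in> P_plus \<Longrightarrow> AE x in l. 0 \<le> x"
  by (rule AE_I[OF _ P_plus_emeasure_neg]) (auto simp: P_plus_sets)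

lemma P_plusI: "prob_space l \<Longrightarrow> sets l = sets borel \<Longrightarrow> emeasure l {..<0} = 0 \<Longrightarrow> l \<in> P_plus"
  by (simp add: P_plus_def half_line_measure_def)

lemma dirac_in_P_plus: "0 \<le> x \<Longrightarrow> \<delta> x \<in> P_plus"
  by (auto intro!: P_plusI prob_space_return)

lemma weak_conv_dirac:
  assumes "X \<longlonglongrightarrow> x"
  shows "weak_conv_m (\<lambda>n. \<delta> (X n)) (\<delta> x)"
proof (rule integral_bdd_continuous_conv_imp_weak_conv)
  fix f :: "real \<Rightarrow> real"
  assume f: "\<And>x. isCont f x"
  then have [measurable]: "f \<in> borel_measurable borel"
    by (intro borel_measurable_continuous_onI) (simp add: continuous_at_imp_continuous_on)
  show "(\<lambda>n. integral\<^sup>L (\<delta> (X n)) f) \<longlonglongrightarrow> integral\<^sup>L (\<delta> x) f"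
    by (simp add: integral_return isCont_tendsto_compose[OF f assms])
qed (auto simp: real_distribution_def real_distribution_axioms_def prob_space_return)

section \<open>Mixtures and the removal of an atom\<close>

lemma emeasure_mixture:
  assumes "sets N = sets M" "A \<in> sets M"
  shows "emeasure (Defs.mixture p M N) A = ennreal p * emeasure M A + ennreal (1 - p) * emeasure N A"
  using assms by (simp add: Defs.mixture_def emeasure_add_measure)

lemma sets_mixture [simp]: "sets (Defs.mixture p M N) = sets M"
  by (simp add: Defs.mixture_def add_measure_def space_scale_measure sets.sigma_sets_eq sets.space_closed)

text \<open>Covers the degenerate case of splitting off an atom, in which no mass remains to
  condition on.\<close>

lemma dirac_if_emeasure_1:
  assumes l: "l \<in> P_plus" and 1: "emeasure l {x} = 1"
  shows "l = \<delta> x"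
proof -
  interpret prob_space l by (rule P_plus_prob_space[OF l])
  have [measurable_cong]: "sets l = sets borel" by (rule P_plus_sets[OF l])
  have AE: "AE y in l. y = x"
    using 1 by (subst AE_in_set_eq_1[of "{x}", simplified]) (auto simp: measure_def)
  show ?thesis
  proof (rule measure_eqI)
    fix A assume "A \<in> sets l"
    then have [measurable]: "A \<in> sets borel" by (simp add: P_plus_sets[OF l])
    have "emeasure l A = (\<integral>\<^sup>+y. indicator A y \<partial>l)" by simp
    also have "\<dots> = (\<integral>\<^sup>+y. indicator A x \<partial>l)"
      using AE by (intro nn_integral_cong_AE) auto
    finally show "emeasure l A = emeasure (\<delta> x) A"
      by (simp add: emeasure_space_1)
  qed (simp add: P_plus_sets[OF l])
qed

text \<open>The remainder \<open>l'\<close> is \<open>l\<close> conditioned on \<open>F\<close>.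
  This is possible because \<open>F\<close> carries the mass \<open>1 - measure l {x}\<close>, which
  is positive; weighting \<open>l'\<close> by the same number recovers \<open>l\<close> on
  \<open>F\<close>.\<close>

lemma P_plus_split_atom:
  assumes l: "l \<in> P_plus" and F: "finite F" "x \<notin> F"
    and supp: "emeasure l (- insert x F) = 0" and ne1: "emeasure l {x} \<noteq> 1"
  obtains l' where "l' \<in> P_plus" "emeasure l' (- F) = 0"
    "l = Defs.mixture (measure l {x}) (\<delta> x) l'"
proof -
  interpret prob_space l by (rule P_plus_prob_space[OF l])
  have [measurable_cong]: "sets l = sets borel" by (rule P_plus_sets[OF l])
  have sp: "space l = UNIV" by (rule P_plus_space[OF l])
  have [measurable]: "F \<in> sets borel" using F(1) by (simp add: finite_imp_closed)
  let ?p = "measure l {x}"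
  have "measure l (insert x F) = 1"
    using supp prob_compl[of "- insert x F"] by (simp add: sp measure_def Compl_eq_Diff_UNIV[symmetric])
  moreover have "measure l (insert x F) = ?p + measure l F"
    using finite_measure_Union[of "{x}" F] F(2) by simp
  ultimately have pF: "measure l F = 1 - ?p" by simp
  have "?p \<noteq> 1" using ne1 by (simp add: emeasure_eq_measure)
  then have F0: "emeasure l F \<noteq> 0" by (simp add: emeasure_eq_measure pF ennreal_eq_0_iff
        not_le order_less_le)
  have le1: "?p \<le> 1" by simp
  define l' where "l' = uniform_measure l F"
  have em: "emeasure l' A = emeasure l (F \<inter> A) / emeasure l F" if "A \<in> sets borel" for A
    using that unfolding l'_def by (subst emeasure_uniform_measure) (simp_all add: P_plus_sets[OF l])
  have sl': "sets l' = sets borel" by (simp add: l'_def P_plus_sets[OF l])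
  show thesis
  proof
    show "l' \<in> P_plus"
    proof (rule P_plusI[OF _ sl'])
      show "prob_space l'" unfolding l'_def using F0 by (intro prob_space_uniform_measure) auto
      have "emeasure l (F \<inter> {..<0}) \<le> 0"
        using P_plus_emeasure_neg[OF l] by (metis emeasure_mono Int_lower2 lessThan_borel P_plus_sets[OF l])
      then show "emeasure l' {..<0} = 0" by (simp add: em)
    qed
    show "emeasure l' (- F) = 0" by (simp add: em)
    show "l = Defs.mixture ?p (\<delta> x) l'"
    proof (rule measure_eqI)
      fix A assume "A \<in> sets l"
      then have [measurable]: "A \<in> sets borel" by (simp add: P_plus_sets[OF l])
      have "emeasure l A = emeasure l (A \<inter> insert x F)"
      proof (rule emeasure_eq_AE)
        have "AE y in l. y \<in> insert x F"
          by (rule AE_I[OF _ supp]) (auto simp: sp)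
        then show "AE y in l. (y \<in> A) = (y \<in> A \<inter> insert x F)" by auto
      qed auto
      also have "\<dots> = emeasure l (A \<inter> {x}) + emeasure l (F \<inter> A)"
      proof -
        have "A \<inter> insert x F = (A \<inter> {x}) \<union> (F \<inter> A)" by auto
        then show ?thesis using F(2) by (subst plus_emeasure) auto
      qed
      also have "emeasure l (A \<inter> {x}) = ennreal ?p * emeasure (\<delta> x) A"
        by (cases "x \<in> A") (auto simp: emeasure_eq_measure)
      also have "emeasure l (F \<inter> A) = ennreal (1 - ?p) * emeasure l' A"
        using F0 mult_divide_eq_ennreal[of "emeasure l F" "emeasure l (F \<inter> A)"]
        by (simp add: em ennreal_times_divide pF[symmetric] emeasure_eq_measure[symmetric]
            mult.commute)
      finally show "emeasure l A = emeasure (Defs.mixture ?p (\<delta> x) l') A"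
        by (simp add: emeasure_mixture sl')
    qed (simp add: P_plus_sets[OF l])
  qed
qed

section \<open>The convolution as a mixture of convolutions with point masses\<close>

context generalized_convolution
begin

text \<open>Truncating at \<open>0\<close> makes the kernel continuous on the whole line; the axioms only concern
  measures on the half-line.\<close>

definition translate :: "real measure \<Rightarrow> real \<Rightarrow> real measure" where
  "translate \<mu> x = \<delta> (max 0 x) \<diamondop> \<mu>"

lemma translate_nonneg: "0 \<le> x \<Longrightarrow> translate \<mu> x = \<delta> x \<diamondop> \<mu>"
  by (simp add: translate_def max_absorb2)

lemma translate_in_P_plus: "\<mu> \<in> P_plus \<Longrightarrow> translate \<mu> x \<in> P_plus"
  by (simp add: translate_def closed dirac_in_P_plus)

section \<open>Continuity and measurability of the kernel\<close>

lemma weak_conv_translate: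
  assumes "\<mu> \<in> P_plus" "X \<longlonglongrightarrow> x"
  shows "weak_conv_m (\<lambda>n. translate \<mu> (X n)) (translate \<mu> x)"
  unfolding translate_def
proof (rule weakly_continuous)
  show "weak_conv_m (\<lambda>n. \<delta> (max 0 (X n))) (\<delta> (max 0 x))"
    using assms(2) by (intro weak_conv_dirac tendsto_max) auto
  show "weak_conv_m (\<lambda>n. \<mu>) \<mu>"
    by (simp add: weak_conv_m_def weak_conv_def)
qed (use assms in \<open>auto simp: dirac_in_P_plus\<close>)

text \<open>Sequential continuity: weak convergence of the translates gives convergence of integrals
  of bounded continuous functions.\<close>

lemma isCont_integral_translate:
  fixes f :: "real \<Rightarrow> real"
  assumes \<mu>: "\<mu> \<in> P_plus" and f: "\<And>x. isCont f x" "\<And>x. norm (f x) \<le> B"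
  shows "isCont (\<lambda>x. integral\<^sup>L (translate \<mu> x) f) y"
proof (rule continuous_at_sequentiallyI)
  fix X :: "nat \<Rightarrow> real" assume "X \<longlonglongrightarrow> y"
  show "(\<lambda>n. integral\<^sup>L (translate \<mu> (X n)) f) \<longlonglongrightarrow> integral\<^sup>L (translate \<mu> y) f"
    using weak_conv_translate[OF \<mu> \<open>X \<longlonglongrightarrow> y\<close>] f
    by (rule weak_conv_imp_integral_bdd_continuous_conv[rotated 2])
      (intro P_plus_real_distribution translate_in_P_plus \<mu>)+
qed

lemma measurable_integral_translate:
  fixes f :: "real \<Rightarrow> real"
  assumes "\<mu> \<in> P_plus" "\<And>x. isCont f x" "\<And>x. norm (f x) \<le> B"
  shows "(\<lambda>x. integral\<^sup>L (translate \<mu> x) f) \<in> borel_measurable borel"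
  using isCont_integral_translate[OF assms]
  by (intro borel_measurable_continuous_onI) (simp add: continuous_at_imp_continuous_on)

text \<open>The rays \<open>{..a}\<close> generate the Borel sets, so it is enough that the
  distribution function at \<open>a\<close> is measurable in \<open>x\<close>. It is a pointwise
  limit of ramp integrals, each of which is continuous in \<open>x\<close>.\<close>

lemma measurable_translate:
  assumes \<mu>: "\<mu> \<in> P_plus"
  shows "translate \<mu> \<in> borel \<rightarrow>\<^sub>M subprob_algebra borel"
proof (rule measurable_subprob_algebra_generated)
  show "sets borel = sigma_sets UNIV (range (\<lambda>a::real. {..a}))"
    by (subst borel_eq_atMost) simp
  show "Int_stable (range (\<lambda>a::real. {..a}))"
    by (auto simp: Int_stable_def)
  fix x
  show "subprob_space (translate \<mu> x)"
    by (intro prob_space_imp_subprob_space P_plus_prob_space translate_in_P_plus \<mu>)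
  show "sets (translate \<mu> x) = sets borel"
    by (intro P_plus_sets translate_in_P_plus \<mu>)
next
  fix A assume "A \<in> range (\<lambda>a::real. {..a})"
  then obtain a where A: "A = {..a}" by auto
  have "(\<lambda>x. cdf (translate \<mu> x) a) \<in> borel_measurable borel"
    using real_distribution.cts_step_tendsto_cdf[OF P_plus_real_distribution[OF translate_in_P_plus[OF \<mu>]], of _ a]
    by (rule borel_measurable_LIMSEQ_real)
      (auto intro!: measurable_integral_translate[OF \<mu>] isCont_cts_step norm_cts_step_le_1)
  moreover have "emeasure (translate \<mu> x) A = ennreal (cdf (translate \<mu> x) a)" for x
    using P_plus_prob_space[OF translate_in_P_plus[OF \<mu>]]
    by (simp add: A cdf_def finite_measure.emeasure_eq_measure prob_space.finite_measure)
  ultimately show "(\<lambda>x. emeasure (translate \<mu> x) A) \<in> borel_measurable borel"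
    by simp
next
  have "emeasure (translate \<mu> x) UNIV = 1" for x
    using prob_space.emeasure_space_1[OF P_plus_prob_space[OF translate_in_P_plus[OF \<mu>]]]
    by (simp add: P_plus_space[OF translate_in_P_plus[OF \<mu>]])
  then show "(\<lambda>x. emeasure (translate \<mu> x) UNIV) \<in> borel_measurable borel"
    by simp
qed auto

lemma measurable_translate_P_plus:
  "\<mu> \<in> P_plus \<Longrightarrow> l \<in> P_plus \<Longrightarrow> translate \<mu> \<in> l \<rightarrow>\<^sub>M subprob_algebra borel"
  using measurable_translate by (simp cong: measurable_cong_sets add: P_plus_sets)

lemma emeasure_bind_translate:
  assumes "\<mu> \<in> P_plus" "l \<in> P_plus" "A \<in> sets borel"
  shows "emeasure (l \<bind> translate \<mu>) A = (\<integral>\<^sup>+x. emeasure (translate \<mu> x) A \<partial>l)"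
  using assms by (intro emeasure_bind[OF _ measurable_translate_P_plus]) (auto simp: P_plus_space)

lemma sets_bind_translate:
  "\<mu> \<in> P_plus \<Longrightarrow> l \<in> P_plus \<Longrightarrow> sets (l \<bind> translate \<mu>) = sets borel"
  by (intro sets_bind) (auto simp: P_plus_space P_plus_sets translate_in_P_plus)

lemma prob_space_bind_translate:
  assumes "\<mu> \<in> P_plus" "l \<in> P_plus"
  shows "prob_space (l \<bind> translate \<mu>)"
proof (rule prob_space.prob_space_bind[OF P_plus_prob_space[OF assms(2)]])
  show "translate \<mu> \<in> l \<rightarrow>\<^sub>M subprob_algebra borel"
    by (rule measurable_translate_P_plus[OF assms])
qed (simp add: P_plus_prob_space translate_in_P_plus assms)

text \<open>Induction on the support: the mixture axiom handles one atom \<open>x\<close>, and the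
  remainder \<open>l'\<close> lives on the smaller set. The measure is kept arbitrary because the
  induction hypothesis is applied to \<open>l'\<close>.\<close>

lemma emeasure_conv_finite_support:
  assumes "finite F" "F \<subseteq> {0..}" "l \<in> P_plus" "emeasure l (- F) = 0" "\<mu> \<in> P_plus"
    "A \<in> sets borel"
  shows "emeasure (l \<diamondop> \<mu>) A = (\<Sum>x\<in>F. emeasure l {x} * emeasure (\<delta> x \<diamondop> \<mu>) A)"
  using assms(1-4)
proof (induction F arbitrary: l rule: finite_induct)
  case empty
  then show ?case
    using prob_space.emeasure_space_1[OF P_plus_prob_space, of l] by (simp add: P_plus_space)
next
  case (insert x F)
  note \<mu> = \<open>\<mu> \<in> P_plus\<close> and A = \<open>A \<in> sets borel\<close> and l = \<open>l \<in> P_plus\<close>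
  have x: "0 \<le> x" using insert.prems by simp
  show ?case
  proof (cases "emeasure l {x} = 1")
    case True
    then have lx: "l = \<delta> x" by (rule dirac_if_emeasure_1[OF l])
    then have "(\<Sum>y\<in>F. emeasure l {y} * emeasure (\<delta> y \<diamondop> \<mu>) A) = 0"
      using insert.hyps by (intro sum.neutral) (auto simp: indicator_def)
    then show ?thesis
      by (simp only: sum.insert[OF insert.hyps] True mult_1 add_0_right) (simp only: lx)
  next
    case False
    let ?p = "measure l {x}"
    obtain l' where l': "l' \<in> P_plus" "emeasure l' (- F) = 0"
      and mix: "l = Defs.mixture ?p (\<delta> x) l'"
      using P_plus_split_atom[OF l insert.hyps insert.prems(3) False] by blast
    interpret prob_space l by (rule P_plus_prob_space[OF l])
    have em: "emeasure l B = ennreal ?p * emeasure (\<delta> x) B + ennreal (1 - ?p) * emeasure l' B"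
      if "B \<in> sets borel" for B
      using that by (subst mix, subst emeasure_mixture) (simp_all add: P_plus_sets[OF l'(1)])
    have "l \<diamondop> \<mu> = Defs.mixture ?p (\<delta> x \<diamondop> \<mu>) (l' \<diamondop> \<mu>)"
      using mixture[OF dirac_in_P_plus[OF x] l'(1) \<mu>, of ?p] mix by simp
    then have "emeasure (l \<diamondop> \<mu>) A =
        ennreal ?p * emeasure (\<delta> x \<diamondop> \<mu>) A + ennreal (1 - ?p) * emeasure (l' \<diamondop> \<mu>) A"
      using A by (simp add: emeasure_mixture P_plus_sets closed l' \<mu> dirac_in_P_plus x)
    also have "emeasure (l' \<diamondop> \<mu>) A = (\<Sum>y\<in>F. emeasure l' {y} * emeasure (\<delta> y \<diamondop> \<mu>) A)"
      using insert.IH[OF _ l'] insert.prems by simp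
    also have "ennreal (1 - ?p) * \<dots> = (\<Sum>y\<in>F. emeasure l {y} * emeasure (\<delta> y \<diamondop> \<mu>) A)"
      unfolding sum_distrib_left
    proof (rule sum.cong[OF refl])
      fix y assume "y \<in> F"
      \<comment> \<open>Here \<open>y\<close> differs from \<open>x\<close>, so the Dirac part of
        the mixture gives \<open>{y}\<close> no mass.\<close>
      then have "emeasure l {y} = ennreal (1 - ?p) * emeasure l' {y}"
        using insert.hyps by (subst em) (auto simp: indicator_def)
      then show "ennreal (1 - ?p) * (emeasure l' {y} * emeasure (\<delta> y \<diamondop> \<mu>) A) =
          emeasure l {y} * emeasure (\<delta> y \<diamondop> \<mu>) A"
        by (simp add: mult.assoc)
    qed
    finally show ?thesis
      using insert.hyps by (simp add: emeasure_eq_measure)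
  qed
qed

lemma conv_eq_bind_finite_support:
  assumes F: "finite F" "F \<subseteq> {0..}" and l: "l \<in> P_plus" "emeasure l (- F) = 0"
    and \<mu>: "\<mu> \<in> P_plus"
  shows "l \<diamondop> \<mu> = l \<bind> translate \<mu>"
proof (rule measure_eqI)
  have [measurable_cong]: "sets l = sets borel" by (rule P_plus_sets[OF l(1)])
  fix A assume "A \<in> sets (l \<diamondop> \<mu>)"
  then have A: "A \<in> sets borel" by (simp add: P_plus_sets closed l \<mu>)
  have "AE x in l. x \<in> F"
    by (rule AE_I[OF _ l(2)]) (use F(1) in \<open>auto simp: P_plus_space l finite_imp_closed\<close>)
  then have "(\<integral>\<^sup>+x. emeasure (translate \<mu> x) A \<partial>l) =
      (\<integral>\<^sup>+x. emeasure (translate \<mu> x) A * indicator F x \<partial>l)"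
    by (intro nn_integral_cong_AE) auto
  also have "\<dots> = (\<Sum>x\<in>F. emeasure (translate \<mu> x) A * emeasure l {x})"
    using F(1) by (intro nn_integral_indicator_finite) auto
  also have "\<dots> = emeasure (l \<diamondop> \<mu>) A"
    unfolding emeasure_conv_finite_support[OF F l \<mu> A]
    using F(2) by (intro sum.cong) (auto simp: translate_nonneg mult.commute)
  finally show "emeasure (l \<diamondop> \<mu>) A = emeasure (l \<bind> translate \<mu>) A"
    by (simp add: emeasure_bind_translate \<mu> l A)
qed (simp add: P_plus_sets closed l \<mu> sets_bind_translate)

text \<open>Ramps are nonnegative, so the iterated integral formula for \<open>bind\<close> can be
  used for the nonnegative integral and carried back to the real-valued one.\<close>

lemma integral_bind_translate_cts_step:
  assumes \<mu>: "\<mu> \<in> P_plus" and l: "l \<in> P_plus" and "a < b"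
  shows "integral\<^sup>L (l \<bind> translate \<mu>) (cts_step a b) =
    (\<integral>x. integral\<^sup>L (translate \<mu> x) (cts_step a b) \<partial>l)"
proof -
  let ?f = "cts_step a b"
  have [measurable]: "?f \<in> borel_measurable borel"
    using isCont_cts_step[OF \<open>a < b\<close>]
    by (intro borel_measurable_continuous_onI) (simp add: continuous_at_imp_continuous_on)
  have int: "integrable k ?f" if "k \<in> P_plus" for k
    using real_distribution.integrable_cts_step[OF P_plus_real_distribution[OF that] \<open>a < b\<close>] .
  have "integral\<^sup>L (l \<bind> translate \<mu>) ?f = enn2real (\<integral>\<^sup>+y. ennreal (?f y) \<partial>(l \<bind> translate \<mu>))"
    by (intro integral_eq_nn_integral)
      (auto simp: cts_step_nonneg measurable_cong_sets[OF sets_bind_translate[OF \<mu> l] refl])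
  also have "(\<integral>\<^sup>+y. ennreal (?f y) \<partial>(l \<bind> translate \<mu>)) =
      (\<integral>\<^sup>+x. (\<integral>\<^sup>+y. ennreal (?f y) \<partial>translate \<mu> x) \<partial>l)"
    by (rule nn_integral_bind[OF _ measurable_translate_P_plus[OF \<mu> l]]) simp
  also have "\<dots> = (\<integral>\<^sup>+x. ennreal (integral\<^sup>L (translate \<mu> x) ?f) \<partial>l)"
    by (intro nn_integral_cong nn_integral_eq_integral int translate_in_P_plus \<mu>)
      (auto simp: cts_step_nonneg)
  also have "enn2real \<dots> = (\<integral>x. integral\<^sup>L (translate \<mu> x) ?f \<partial>l)"
    using measurable_integral_translate[OF \<mu> isCont_cts_step[OF \<open>a < b\<close>] norm_cts_step_le_1]
    by (intro integral_eq_nn_integral[symmetric])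
      (auto simp: cts_step_nonneg measurable_cong_sets[OF P_plus_sets[OF l] refl])
  finally show ?thesis .
qed

end

section \<open>Weak approximation by finitely supported measures\<close>

text \<open>The approximations are the laws of \<open>\<lfloor>n X\<rfloor> / n\<close>, capped at \<open>n\<close>.\<close>

lemma P_plus_finite_support_approx:
  assumes l: "l \<in> P_plus"
  obtains ls F where "\<And>n. ls n \<in> P_plus" "\<And>n. finite (F n)" "\<And>n. F n \<subseteq> {0..}"
    "\<And>n::nat. emeasure (ls n) (- F n) = 0" "weak_conv_m ls l"
proof -
  interpret prob_space l by (rule P_plus_prob_space[OF l])
  have [measurable_cong]: "sets l = sets borel" by (rule P_plus_sets[OF l])
  \<comment> \<open>The cap \<open>n * n\<close> is applied before the division by \<open>n\<close>,
    hence amounts to the cap \<open>n\<close> afterwards. For \<open>n = 0\<close> division by zero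
    gives the constant \<open>0\<close>, still a nonnegative value.\<close>
  define g :: "nat \<Rightarrow> real \<Rightarrow> real" where
    "g n x = of_int (max 0 (min (int n * int n) \<lfloor>real n * x\<rfloor>)) / real n" for n x
  have [measurable]: "g n \<in> borel_measurable borel" for n
    unfolding g_def by measurable
  have g_nonneg: "0 \<le> g n x" for n x by (simp add: g_def)
  have g_lim: "(\<lambda>n. g n x) \<longlonglongrightarrow> x" if x: "0 \<le> x" for x
  proof (rule LIMSEQ_I)
    fix e :: real assume "0 < e"
    \<comment> \<open>Beyond \<open>x\<close> the cap is inactive; beyond \<open>1 / e\<close> the
      rounding error, at most \<open>1 / n\<close>, is below \<open>e\<close>.\<close>
    obtain N where N: "max x (1 / e) < real N" using reals_Archimedean2 by blast
    show "\<exists>N. \<forall>n\<ge>N. norm (g n x - x) < e"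
    proof (intro exI allI impI)
      fix n assume "N \<le> n"
      then have n: "x < real n" "1 / e < real n" using N by auto
      then have n0: "0 < real n" using x by linarith
      have "real n * x \<le> real n * real n" using n x by (intro mult_left_mono) auto
      then have "\<lfloor>real n * x\<rfloor> \<le> int n * int n"
        by (metis floor_mono floor_of_int of_int_mult of_int_of_nat_eq)
      moreover have "0 \<le> \<lfloor>real n * x\<rfloor>" using x by simp
      ultimately have g: "g n x = of_int \<lfloor>real n * x\<rfloor> / real n" by (simp add: g_def)
      have "real n * x - 1 < of_int \<lfloor>real n * x\<rfloor>" "of_int \<lfloor>real n * x\<rfloor> \<le> real n * x"
        by linarith+
      then have "\<bar>of_int \<lfloor>real n * x\<rfloor> - real n * x\<bar> / real n \<le> 1 / real n"
        using n0 by (intro divide_right_mono) linarith+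
      also have "1 / real n < e" using n n0 \<open>0 < e\<close> by (simp add: field_simps)
      also have "\<bar>of_int \<lfloor>real n * x\<rfloor> - real n * x\<bar> / real n = \<bar>g n x - x\<bar>"
      proof -
        have "(of_int \<lfloor>real n * x\<rfloor> - real n * x) / real n = g n x - x"
          using n0 by (simp add: g diff_divide_distrib)
        then show ?thesis by (metis abs_divide abs_of_nat)
      qed
      finally show "norm (g n x - x) < e" by simp
    qed
  qed
  define F where "F n = (\<lambda>i. of_int i / real n) ` {0..int n * int n}" for n :: nat
  have gF: "g n x \<in> F n" for n x
    unfolding F_def g_def by (rule imageI) auto
  show thesis
  proof
    show "distr l borel (g n) \<in> P_plus" for n
      by (intro P_plusI prob_space_distr) (auto simp: emeasure_distr g_nonneg[THEN leD] vimage_def)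
    show "finite (F n)" for n by (simp add: F_def)
    then have [measurable]: "F n \<in> sets borel" for n by (simp add: finite_imp_closed)
    show "F n \<subseteq> {0..}" for n by (auto simp: F_def)
    show "emeasure (distr l borel (g n)) (- F n) = 0" for n
      by (subst emeasure_distr) (auto simp: vimage_def gF)
    show "weak_conv_m (\<lambda>n. distr l borel (g n)) l"
    proof (rule integral_bdd_continuous_conv_imp_weak_conv)
      fix f :: "real \<Rightarrow> real"
      assume f: "\<And>x. isCont f x" "\<And>x. \<bar>f x\<bar> \<le> 1"
      then have [measurable]: "f \<in> borel_measurable borel"
        by (intro borel_measurable_continuous_onI) (simp add: continuous_at_imp_continuous_on)
      have "(\<lambda>n. \<integral>x. f (g n x) \<partial>l) \<longlonglongrightarrow> (\<integral>x. f x \<partial>l)"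
      proof (rule integral_dominated_convergence[where w = "\<lambda>_. 1"])
        show "AE x in l. (\<lambda>n. f (g n x)) \<longlonglongrightarrow> f x"
          using P_plus_AE_nonneg[OF l] by eventually_elim (intro isCont_tendsto_compose[OF f(1)] g_lim)
      qed (auto simp: f)
      then show "(\<lambda>n. integral\<^sup>L (distr l borel (g n)) f) \<longlonglongrightarrow> integral\<^sup>L l f"
        by (simp add: integral_distr)
    qed (auto intro!: P_plus_real_distribution l real_distribution_distr)
  qed
qed

section \<open>The mixture formula for arbitrary measures\<close>

context generalized_convolution
begin

text \<open>Integrals of a ramp over \<open>ls n \<diamondop> \<mu>\<close> have two limits. Weak
  continuity of the convolution gives the left side; the finite-support formula rewrites them as
  integrals of \<open>?\<phi>\<close> over \<open>ls n\<close>, and \<open>?\<phi>\<close> is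
  bounded and continuous, which gives the right side.\<close>

theorem conv_eq_bind:
  assumes l: "l \<in> P_plus" and \<mu>: "\<mu> \<in> P_plus"
  shows "l \<diamondop> \<mu> = l \<bind> translate \<mu>"
proof (rule real_distribution_eqI_cts_step)
  show "real_distribution (l \<diamondop> \<mu>)"
    by (intro P_plus_real_distribution closed l \<mu>)
  show "real_distribution (l \<bind> translate \<mu>)"
    by (simp add: real_distribution_def real_distribution_axioms_def prob_space_bind_translate
        sets_bind_translate l \<mu>)
  fix a b :: real assume "a < b"
  let ?f = "cts_step a b" and ?\<phi> = "\<lambda>x. integral\<^sup>L (translate \<mu> x) (cts_step a b)"
  obtain ls F where ls: "\<And>n. ls n \<in> P_plus" and F: "\<And>n. finite (F n)" "\<And>n. F n \<subseteq> {0..}"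
    and supp: "\<And>n::nat. emeasure (ls n) (- F n) = 0" and conv: "weak_conv_m ls l"
    by (rule P_plus_finite_support_approx[OF l]) blast
  have "weak_conv_m (\<lambda>n. ls n \<diamondop> \<mu>) (l \<diamondop> \<mu>)"
    by (intro weakly_continuous[OF ls _ l \<mu> conv]) (auto simp: \<mu> weak_conv_m_def weak_conv_def)
  then have "(\<lambda>n. integral\<^sup>L (ls n \<diamondop> \<mu>) ?f) \<longlonglongrightarrow> integral\<^sup>L (l \<diamondop> \<mu>) ?f"
    by (intro weak_conv_imp_integral_bdd_continuous_conv[where B = 1] P_plus_real_distribution
        closed ls l \<mu> isCont_cts_step \<open>a < b\<close> norm_cts_step_le_1)
  moreover have "integral\<^sup>L (ls n \<diamondop> \<mu>) ?f = integral\<^sup>L (ls n) ?\<phi>" for n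
    by (simp add: conv_eq_bind_finite_support[OF F ls supp \<mu>]
        integral_bind_translate_cts_step[OF \<mu> ls \<open>a < b\<close>])
  moreover have "(\<lambda>n. integral\<^sup>L (ls n) ?\<phi>) \<longlonglongrightarrow> integral\<^sup>L l ?\<phi>"
  proof (rule weak_conv_imp_integral_bdd_continuous_conv[OF _ _ conv, where B = 1])
    show "isCont ?\<phi> x" for x
      by (intro isCont_integral_translate[where B = 1] \<mu> isCont_cts_step \<open>a < b\<close> norm_cts_step_le_1)
    fix x
    interpret T: real_distribution "translate \<mu> x"
      by (intro P_plus_real_distribution translate_in_P_plus \<mu>)
    have "?\<phi> x \<le> 1"
      by (intro T.integral_le_const T.integrable_cts_step \<open>a < b\<close>) (simp add: cts_step_le_1)
    moreover have "0 \<le> ?\<phi> x" by (simp add: cts_step_nonneg)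
    ultimately show "norm (?\<phi> x) \<le> 1" by simp
  qed (auto intro: P_plus_real_distribution ls l)
  ultimately have "integral\<^sup>L (l \<diamondop> \<mu>) ?f = integral\<^sup>L l ?\<phi>"
    by (simp add: LIMSEQ_unique)
  then show "integral\<^sup>L (l \<diamondop> \<mu>) ?f = integral\<^sup>L (l \<bind> translate \<mu>) ?f"
    by (simp add: integral_bind_translate_cts_step[OF \<mu> l \<open>a < b\<close>])
qed

corollary emeasure_conv:
  assumes "l \<in> P_plus" "\<mu> \<in> P_plus" "A \<in> sets borel"
  shows "emeasure (l \<diamondop> \<mu>) A = (\<integral>\<^sup>+x. emeasure (translate \<mu> x) A \<partial>l)"
  using assms by (simp add: conv_eq_bind emeasure_bind_translate)

end

section \<open>The renewal measure\<close>

lemma half_line_measureD: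
  assumes "half_line_measure m"
  shows "sets m = sets borel" "space m = UNIV" "AE x in m. 0 \<le> x"
proof -
  show m: "sets m = sets borel" using assms by (simp add: half_line_measure_def)
  show "space m = UNIV" using sets_eq_imp_space_eq[OF m] by simp
  show "AE x in m. 0 \<le> x"
    by (rule AE_I[of _ _ "{..<0}"]) (use assms in \<open>auto simp: half_line_measure_def\<close>)
qed

context generalized_convolution
begin

lemma conv_power_in_P_plus: "\<nu> \<in> P_plus \<Longrightarrow> conv_power (\<diamondop>) \<nu> n \<in> P_plus"
  by (induction n) (simp_all add: closed dirac_in_P_plus)

lemma conv_power_1: "\<nu> \<in> P_plus \<Longrightarrow> conv_power (\<diamondop>) \<nu> (Suc 0) = \<nu>"
  by (simp add: commute[OF dirac_in_P_plus] neutral)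

text \<open>The inner integral is \<nu> convolved with \<open>\<delta> y\<close>, which by
  commutativity is the kernel at \<open>y\<close>. Countable additivity of the set function in
  \<open>conv_ext\<close> is then inherited from \<open>bind\<close>.\<close>

lemma conv_ext_eq_bind:
  assumes \<nu>: "\<nu> \<in> P_plus" and m: "half_line_measure m"
  shows "conv_ext (\<diamondop>) \<nu> m = m \<bind> translate \<nu>"
proof -
  note m' = half_line_measureD[OF m]
  have meas: "translate \<nu> \<in> m \<rightarrow>\<^sub>M subprob_algebra borel"
    using measurable_translate[OF \<nu>] by (simp cong: measurable_cong_sets add: m'(1))
  have sets: "sets (m \<bind> translate \<nu>) = sets borel"
    by (intro sets_bind) (auto simp: m'(2) P_plus_sets translate_in_P_plus \<nu>)
  have inner: "(\<integral>\<^sup>+x\<in>{0..}. emeasure (\<delta> x \<diamondop> \<delta> y) A \<partial>\<nu>) = emeasure (translate \<nu> y) A"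
    if "0 \<le> y" "A \<in> sets borel" for y A
  proof -
    have "(\<integral>\<^sup>+x\<in>{0..}. emeasure (\<delta> x \<diamondop> \<delta> y) A \<partial>\<nu>) = (\<integral>\<^sup>+x. emeasure (translate (\<delta> y) x) A \<partial>\<nu>)"
      using P_plus_AE_nonneg[OF \<nu>] by (intro nn_integral_cong_AE) (auto simp: translate_nonneg)
    also have "\<dots> = emeasure (\<nu> \<diamondop> \<delta> y) A"
      by (simp add: emeasure_conv \<nu> dirac_in_P_plus that)
    finally show ?thesis
      using that by (simp add: translate_nonneg commute[OF \<nu> dirac_in_P_plus])
  qed
  have "(\<integral>\<^sup>+y\<in>{0..}. (\<integral>\<^sup>+x\<in>{0..}. emeasure (\<delta> x \<diamondop> \<delta> y) A \<partial>\<nu>) \<partial>m) = emeasure (m \<bind> translate \<nu>) A"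
    if A: "A \<in> sets borel" for A
  proof -
    have "(\<integral>\<^sup>+y\<in>{0..}. (\<integral>\<^sup>+x\<in>{0..}. emeasure (\<delta> x \<diamondop> \<delta> y) A \<partial>\<nu>) \<partial>m) =
        (\<integral>\<^sup>+y. emeasure (translate \<nu> y) A \<partial>m)"
      using m'(3) by (intro nn_integral_cong_AE) (auto simp: inner A)
    then show ?thesis
      using A by (simp add: emeasure_bind[OF _ meas] m'(2))
  qed
  \<comment> \<open>Agreement on Borel sets suffices, since \<open>measure_of\<close> depends only
    on the values there.\<close>
  then have "conv_ext (\<diamondop>) \<nu> m = measure_of UNIV (sets borel) (emeasure (m \<bind> translate \<nu>))"
    unfolding conv_ext_def by (intro measure_of_eq) (auto simp: sets.sigma_sets_eq[of borel, simplified])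
  also have "\<dots> = m \<bind> translate \<nu>"
    using measure_of_of_measure[of "m \<bind> translate \<nu>"] sets_eq_imp_space_eq[OF sets]
    by (simp add: sets)
  finally show ?thesis .
qed

text \<open>The series of convolution powers, encoded as a \<open>bind\<close> over counting measure
  so that additivity and integration come with it. \<open>Suc n\<close> makes the series start at
  the first power, leaving out the neutral element.\<close>

definition renewal_measure :: "real measure \<Rightarrow> real measure" where
  "renewal_measure \<nu> = count_space UNIV \<bind> (\<lambda>n::nat. conv_power (\<diamondop>) \<nu> (Suc n))"

lemma measurable_conv_power:
  "\<nu> \<in> P_plus \<Longrightarrow> (\<lambda>n. conv_power (\<diamondop>) \<nu> (Suc n)) \<in> count_space UNIV \<rightarrow>\<^sub>M subprob_algebra borel"
  using conv_power_in_P_plus[of \<nu> "Suc _"]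
  by (auto simp: space_subprob_algebra P_plus_sets P_plus_prob_space prob_space_imp_subprob_space
      simp del: conv_power.simps)

lemma sets_renewal_measure: "\<nu> \<in> P_plus \<Longrightarrow> sets (renewal_measure \<nu>) = sets borel"
  unfolding renewal_measure_def
  by (intro sets_bind P_plus_sets conv_power_in_P_plus) auto

lemma emeasure_renewal_measure:
  assumes "\<nu> \<in> P_plus" "A \<in> sets borel"
  shows "emeasure (renewal_measure \<nu>) A = (\<Sum>n. emeasure (conv_power (\<diamondop>) \<nu> (Suc n)) A)"
  unfolding renewal_measure_def using assms
  by (subst emeasure_bind[OF _ measurable_conv_power])
    (simp_all add: nn_integral_count_space_nat del: conv_power.simps)

lemma half_line_renewal_measure: "\<nu> \<in> P_plus \<Longrightarrow> half_line_measure (renewal_measure \<nu>)"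
  by (simp add: half_line_measure_def sets_renewal_measure emeasure_renewal_measure
      P_plus_emeasure_neg conv_power_in_P_plus del: conv_power.simps)

lemma countable_sum_renewal_measure:
  assumes "\<nu> \<in> P_plus"
  shows "countable_sum_of_prob (renewal_measure \<nu>)"
  unfolding countable_sum_of_prob_def
  using assms
  by (intro conjI sets_renewal_measure exI[of _ UNIV] exI[of _ "\<lambda>n. conv_power (\<diamondop>) \<nu> (Suc n)"])
    (simp_all add: conv_power_in_P_plus emeasure_renewal_measure nn_integral_count_space_nat
      del: conv_power.simps)

text \<open>Integrating the kernel against one power yields the next power, so the convolution term
  is the series without its first summand, and that summand is \<nu>.\<close>

lemma renewal_equation:
  assumes \<nu>: "\<nu> \<in> P_plus"
  shows "renewal_measure \<nu> = add_measure \<nu> (conv_ext (\<diamondop>) \<nu> (renewal_measure \<nu>))"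
proof -
  let ?m = "renewal_measure \<nu>" and ?p = "conv_power (\<diamondop>) \<nu>"
  note m = half_line_renewal_measure[OF \<nu>]
  have meas: "translate \<nu> \<in> ?m \<rightarrow>\<^sub>M subprob_algebra borel"
    using measurable_translate[OF \<nu>] by (simp cong: measurable_cong_sets add: sets_renewal_measure \<nu>)
  have sets: "sets (?m \<bind> translate \<nu>) = sets borel"
    by (intro sets_bind) (auto simp: half_line_measureD[OF m] P_plus_sets translate_in_P_plus \<nu>)
  show ?thesis
    unfolding conv_ext_eq_bind[OF \<nu> m]
  proof (rule measure_eqI)
    show "sets ?m = sets (add_measure \<nu> (?m \<bind> translate \<nu>))"
      by (simp add: add_measure_def sets_renewal_measure P_plus_sets P_plus_space \<nu>
          sets.sigma_sets_eq[of borel, simplified])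
    fix A assume "A \<in> sets ?m"
    then have A: "A \<in> sets borel" by (simp add: sets_renewal_measure \<nu>)
    have "emeasure (?m \<bind> translate \<nu>) A = (\<integral>\<^sup>+y. emeasure (translate \<nu> y) A \<partial>?m)"
      using A by (intro emeasure_bind[OF _ meas]) (simp_all add: half_line_measureD[OF m])
    also have "\<dots> = (\<Sum>n. \<integral>\<^sup>+y. emeasure (translate \<nu> y) A \<partial>?p (Suc n))"
      unfolding renewal_measure_def nn_integral_count_space_nat[symmetric]
      using measurable_translate[OF \<nu>] A
      by (intro nn_integral_bind[OF _ measurable_conv_power[OF \<nu>]])
        (rule measurable_compose[OF _ measurable_emeasure_subprob_algebra])
    also have "\<dots> = (\<Sum>n. emeasure (?p (Suc (Suc n))) A)"
      using \<nu> A by (simp add: emeasure_conv[symmetric] closed conv_power_in_P_plus dirac_in_P_plus)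
    finally have "emeasure \<nu> A + emeasure (?m \<bind> translate \<nu>) A =
        (\<Sum>n. emeasure (?p (Suc (Suc n))) A) + emeasure (?p (Suc 0)) A"
      by (simp add: conv_power_1[OF \<nu>] add.commute del: conv_power.simps)
    also have "\<dots> = (\<Sum>n. emeasure (?p (Suc n)) A)"
      by (intro sums_unique sums_Suc[of "\<lambda>n. emeasure (?p (Suc n)) A"] summable_sums) simp
    finally show "emeasure ?m A = emeasure (add_measure \<nu> (?m \<bind> translate \<nu>)) A"
      using A by (simp add: emeasure_add_measure sets P_plus_sets \<nu> emeasure_renewal_measure
          del: conv_power.simps)
  qed
qed

end

text \<open>A step from \<open>x\<close> cannot land below \<open>q\<close>: each
  \<open>\<delta> y \<diamondop> \<delta> x\<close> is carried by \<open>{max y x..}\<close>, which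
  lies in \<open>{q..}\<close>. Integrating over \<open>y\<close> and commuting gives the claim for
  \<nu>.\<close>

lemma (in monotonic_generalized_convolution) measure_translate_lessThan:
  assumes \<nu>: "\<nu> \<in> P_plus" and x: "0 \<le> x" "q \<le> x"
  shows "measure (\<delta> x \<diamondop> \<nu>) {..<q} = 0"
proof -
  have "emeasure (\<delta> y \<diamondop> \<delta> x) {..<q} = 0" if y: "0 \<le> y" for y
  proof -
    have in_P: "\<delta> y \<diamondop> \<delta> x \<in> P_plus" by (intro closed dirac_in_P_plus x y)
    interpret D: prob_space "\<delta> y \<diamondop> \<delta> x" by (rule P_plus_prob_space[OF in_P])
    have "D.prob (- {max y x..}) = 0"
      using D.prob_compl[of "{max y x..}"] monotonic[OF y x(1)]
      by (simp add: P_plus_sets[OF in_P] P_plus_space[OF in_P] Compl_eq_Diff_UNIV)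
    moreover have "D.prob {..<q} \<le> D.prob (- {max y x..})"
      using x by (intro D.finite_measure_mono) (auto simp: P_plus_sets[OF in_P])
    ultimately show ?thesis by (simp add: D.emeasure_eq_measure measure_le_0_iff)
  qed
  \<comment> \<open>The truncation in \<open>translate\<close> makes the integrand vanish for
    negative \<open>y\<close> as well.\<close>
  then have "(\<integral>\<^sup>+y. emeasure (translate (\<delta> x) y) {..<q} \<partial>\<nu>) = 0"
    by (simp add: translate_def)
  then have "emeasure (\<nu> \<diamondop> \<delta> x) {..<q} = 0"
    using \<nu> x by (simp add: emeasure_conv dirac_in_P_plus)
  then show ?thesis
    by (simp add: measure_def commute[OF \<nu> dirac_in_P_plus[OF x(1)]])
qed

section \<open>Counting renewals along a monotone path\<close>

text \<open>On a nondecreasing path the \<open>n\<close> with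
  \<open>S (Suc n) \<omega> \<le> t\<close> form an initial segment of the naturals, and its length
  is the first \<open>n\<close> that fails. If none fails, both sides are infinite.\<close>

lemma ennreal_renewal_process:
  assumes mono: "\<And>k. S (Suc k) \<omega> \<le> S (Suc (Suc k)) \<omega>"
  shows "ennreal_of_enat (renewal_process S t \<omega>) = (\<Sum>n. indicator {..t} (S (Suc n) \<omega>))"
proof -
  have le: "S (Suc i) \<omega> \<le> S (Suc j) \<omega>" if "i \<le> j" for i j
    using that by (rule lift_Suc_mono_le[where f = "\<lambda>k. S (Suc k) \<omega>", OF mono])
  let ?N = "{n. S (Suc n) \<omega> > t}"
  show ?thesis
  proof (cases "?N = {}")
    case True
    then have "renewal_process S t \<omega> = \<infinity>"
      by (auto simp: renewal_process_def top_enat_def[symmetric])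
    moreover have "(\<Sum>n. indicator {..t} (S (Suc n) \<omega>) :: ennreal) = (\<Sum>n. 1)"
      using True by (intro suminf_cong) (auto simp: not_less)
    moreover have "(\<Sum>n::nat. 1 :: ennreal) = \<infinity>"
      using nn_integral_count_space_nat[of "\<lambda>_. 1"] by simp
    ultimately show ?thesis by simp
  next
    case False
    define k where "k = (LEAST n. S (Suc n) \<omega> > t)"
    have k: "S (Suc k) \<omega> > t" and least: "\<And>n. S (Suc n) \<omega> > t \<Longrightarrow> k \<le> n"
      using False unfolding k_def by (auto intro: LeastI Least_le)
    have "renewal_process S t \<omega> = enat k"
      unfolding renewal_process_def
      by (rule antisym) (use k least in \<open>auto intro!: Inf_lower Inf_greatest\<close>)
    moreover have "(\<Sum>n. indicator {..t} (S (Suc n) \<omega>) :: ennreal) = (\<Sum>n<k. 1)"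
    proof -
      \<comment> \<open>Minimality of \<open>k\<close> settles \<open>n < k\<close>; monotonicity of
        the path settles \<open>k \<le> n\<close>.\<close>
      have "indicator {..t} (S (Suc n) \<omega>) = (if n < k then 1 else 0 :: ennreal)" for n
        using least[of n] le[of k n] k by (cases "n < k") (auto simp: indicator_def intro: leI)
      then show ?thesis
        by (subst suminf_finite[of "{..<k}"]) auto
    qed
    ultimately show ?thesis by (simp add: ennreal_of_nat_eq_real_of_nat)
  qed
qed

section \<open>Random walks\<close>

lemma generalized_random_walkD:
  assumes "generalized_random_walk gc \<nu> M S"
  shows "prob_space M" "distr M borel (S (Suc 0)) = \<nu>"
    and "\<And>n. S (Suc n) \<in> borel_measurable M"
    and "\<And>n \<omega>. \<omega> \<in> space M \<Longrightarrow> 0 \<le> S (Suc n) \<omega>"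
    and "\<And>k n A. 1 \<le> k \<Longrightarrow> k < n \<Longrightarrow> A \<in> sets borel \<Longrightarrow>
      AE \<omega> in M. real_cond_exp M (history M S k) (\<lambda>\<omega>. indicator A (S n \<omega>)) \<omega> =
        measure (gc (\<delta> (S k \<omega>)) (conv_power gc \<nu> (n - k))) A"
  using assms unfolding generalized_random_walk_def by (blast, simp, simp, simp, blast)

section \<open>Histories and conditional expectations\<close>

lemma sets_history: "sets (history M S k) =
    sigma_sets (space M) (\<Union>i\<in>{1..k}. {S i -` A \<inter> space M | A. A \<in> sets borel})"
  unfolding history_def by (intro sets_measure_of) auto

lemma vimage_in_history: "1 \<le> k \<Longrightarrow> A \<in> sets borel \<Longrightarrow> S k -` A \<inter> space M \<in> sets (history M S k)"
  unfolding sets_history by (rule sigma_sets.Basic, rule UN_I[of k]) auto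

lemma space_history: "space (history M S k) = space M"
  unfolding history_def by (intro space_measure_of) auto

lemma subalgebra_history:
  assumes "\<And>n. S (Suc n) \<in> borel_measurable M"
  shows "subalgebra M (history M S k)"
  unfolding subalgebra_def space_history sets_history
proof (intro conjI refl sets.sigma_sets_subset subsetI)
  fix B assume "B \<in> (\<Union>i\<in>{1..k}. {S i -` A \<inter> space M | A. A \<in> sets borel})"
  then obtain i A where "1 \<le> i" "A \<in> sets borel" "B = S i -` A \<inter> space M" by auto
  then show "B \<in> sets M" using assms[of "i - 1"] by (auto intro: measurable_sets)
qed

text \<open>The defining property of conditional expectation, for an event that belongs to the
  history because it depends on \<open>S k\<close> only.\<close>

lemma random_walk_set_integral:
  assumes rw: "generalized_random_walk gc \<nu> M S" and k: "1 \<le> k" "k < n"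
    and A[measurable]: "A \<in> sets borel" and B: "B \<in> sets borel"
  shows "(\<integral>\<omega>. indicator (S k -` B \<inter> space M) \<omega> * indicator A (S n \<omega>) \<partial>M) =
    (\<integral>\<omega>. indicator (S k -` B \<inter> space M) \<omega> *
      real_cond_exp M (history M S k) (\<lambda>\<omega>. indicator A (S n \<omega>)) \<omega> \<partial>M)"
proof -
  note rwD = generalized_random_walkD[OF rw]
  interpret prob_space M by (rule rwD)
  interpret finite_measure_subalgebra M "history M S k"
    by unfold_locales (rule subalgebra_history, rule rwD(3))
  have [measurable]: "S n \<in> borel_measurable M"
    using rwD(3)[of "n - 1"] k by simp
  have "integrable M (\<lambda>\<omega>. indicator A (S n \<omega>) :: real)"
    by (rule integrable_const_bound[of _ 1]) auto
  from real_cond_exp_intA[OF this vimage_in_history[OF k(1) B]] show ?thesis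
    by (simp add: set_lebesgue_integral_def)
qed

context generalized_convolution
begin

text \<open>Condition on the first position: given \<open>S 1 = x\<close>, the law of
  \<open>S (Suc n)\<close> is \<open>\<delta> x\<close> convolved with the power \<open>n\<close>.
  Averaging over the law \<nu> of \<open>S 1\<close> gives the next power, up to commutativity. The
  transition law needs \<open>1 < Suc n\<close>, hence the separate case
  \<open>n = 0\<close>.\<close>

lemma distr_random_walk:
  assumes rw: "generalized_random_walk (\<diamondop>) \<nu> M S" and \<nu>: "\<nu> \<in> P_plus"
  shows "distr M borel (S (Suc n)) = conv_power (\<diamondop>) \<nu> (Suc n)"
proof (cases n)
  case 0
  then show ?thesis using generalized_random_walkD(2)[OF rw] conv_power_1[OF \<nu>] by simp
next
  case (Suc j)
  note rwD = generalized_random_walkD[OF rw]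
  interpret prob_space M by (rule rwD)
  note [measurable] = rwD(3)
  let ?p = "conv_power (\<diamondop>) \<nu> n"
  have p: "?p \<in> P_plus" by (rule conv_power_in_P_plus[OF \<nu>])
  show ?thesis
  proof (rule measure_eqI)
    fix A assume "A \<in> sets (distr M borel (S (Suc n)))"
    then have [measurable]: "A \<in> sets borel" by simp
    have AE: "AE \<omega> in M. real_cond_exp M (history M S 1) (\<lambda>\<omega>. indicator A (S (Suc n) \<omega>)) \<omega> =
        measure (translate ?p (S 1 \<omega>)) A"
      using rwD(5)[of 1 "Suc n" A] Suc by (auto simp: translate_nonneg rwD(4))
    have meas: "(\<lambda>x. measure (translate ?p x) A) \<in> borel_measurable borel"
      by (rule measurable_compose[OF measurable_translate[OF p] measurable_measure_subprob_algebra]) simp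
    have "measure (distr M borel (S (Suc n))) A = (\<integral>\<omega>. indicator A (S (Suc n) \<omega>) \<partial>M)"
      by (simp add: measure_distr integral_indicator flip: indicator_vimage)
    \<comment> \<open>With \<open>B = UNIV\<close> the event is the whole space, so this is the law
      of total expectation.\<close>
    also have "\<dots> = (\<integral>\<omega>. real_cond_exp M (history M S 1) (\<lambda>\<omega>. indicator A (S (Suc n) \<omega>)) \<omega> \<partial>M)"
      using random_walk_set_integral[OF rw, of 1 "Suc n" A UNIV] Suc
      by (simp add: indicator_def cong: Bochner_Integration.integral_cong)
    also have "\<dots> = (\<integral>\<omega>. measure (translate ?p (S 1 \<omega>)) A \<partial>M)"
      using AE measurable_compose[OF rwD(3)[of 0] meas] by (intro integral_cong_AE) simp_all
    also have "\<dots> = (\<integral>x. measure (translate ?p x) A \<partial>\<nu>)"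
      using integral_distr[of "S 1" M borel "\<lambda>x. measure (translate ?p x) A"] rwD(2) rwD(3)[of 0] meas
      by simp
    also have "ennreal \<dots> = (\<integral>\<^sup>+x. emeasure (translate ?p x) A \<partial>\<nu>)"
    proof -
      interpret N: prob_space \<nu> by (rule P_plus_prob_space[OF \<nu>])
      have em: "emeasure (translate ?p x) A = ennreal (measure (translate ?p x) A)" for x
        using P_plus_prob_space[OF translate_in_P_plus[OF p]]
        by (simp add: finite_measure.emeasure_eq_measure prob_space.finite_measure)
      show ?thesis unfolding em
        using meas prob_space.prob_le_1[OF P_plus_prob_space[OF translate_in_P_plus[OF p]]]
        by (intro nn_integral_eq_integral[symmetric] N.integrable_const_bound[of _ 1])
          (auto simp: measurable_cong_sets[OF P_plus_sets[OF \<nu>] refl])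
    qed
    also have "\<dots> = emeasure (conv_power (\<diamondop>) \<nu> (Suc n)) A"
      by (simp add: emeasure_conv[OF \<nu> p, symmetric] commute[OF \<nu> p])
    finally show "emeasure (distr M borel (S (Suc n))) A = emeasure (conv_power (\<diamondop>) \<nu> (Suc n)) A"
      by (simp add: finite_measure.emeasure_eq_measure finite_measure_distr del: conv_power.simps)
  qed (simp add: P_plus_sets conv_power_in_P_plus \<nu> del: conv_power.simps)
qed

end

text \<open>For fixed \<open>q\<close>, a descent from \<open>{q..}\<close> to \<open>{..<q}\<close>
  has conditional probability zero by \<open>measure_translate_lessThan\<close>. Every descent
  crosses some rational, so countably many null events cover all of them.\<close>

lemma (in monotonic_generalized_convolution) random_walk_mono:
  assumes rw: "generalized_random_walk (\<diamondop>) \<nu> M S" and \<nu>: "\<nu> \<in> P_plus"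
  shows "AE \<omega> in M. S (Suc k) \<omega> \<le> S (Suc (Suc k)) \<omega>"
proof -
  note rwD = generalized_random_walkD[OF rw]
  interpret prob_space M by (rule rwD)
  note [measurable] = rwD(3)
  have "AE \<omega> in M. \<not> (S (Suc (Suc k)) \<omega> < q \<and> q \<le> S (Suc k) \<omega>)" for q
  proof -
    let ?f = "\<lambda>\<omega>. indicator (S (Suc k) -` {q..} \<inter> space M) \<omega> * indicator {..<q} (S (Suc (Suc k)) \<omega>) :: real"
    have cond: "AE \<omega> in M. real_cond_exp M (history M S (Suc k))
        (\<lambda>\<omega>. indicator {..<q} (S (Suc (Suc k)) \<omega>)) \<omega> = measure (\<delta> (S (Suc k) \<omega>) \<diamondop> \<nu>) {..<q}"
      using rwD(5)[of "Suc k" "Suc (Suc k)" "{..<q}"] conv_power_1[OF \<nu>] by simp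
    have "integral\<^sup>L M ?f = (\<integral>\<omega>. indicator (S (Suc k) -` {q..} \<inter> space M) \<omega> *
        real_cond_exp M (history M S (Suc k)) (\<lambda>\<omega>. indicator {..<q} (S (Suc (Suc k)) \<omega>)) \<omega> \<partial>M)"
      by (intro random_walk_set_integral[OF rw]) auto
    also have "\<dots> = 0"
    proof (intro integral_eq_zero_AE)
      show "AE \<omega> in M. indicator (S (Suc k) -` {q..} \<inter> space M) \<omega> *
        real_cond_exp M (history M S (Suc k)) (\<lambda>\<omega>. indicator {..<q} (S (Suc (Suc k)) \<omega>)) \<omega> = 0"
        using cond AE_space
      proof eventually_elim
        case (elim \<omega>)
        then show ?case
          using measure_translate_lessThan[OF \<nu> rwD(4)[of \<omega> k], of q] by (auto simp: indicator_def)
      qed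
    qed
    \<comment> \<open>\<open>?f\<close> is the indicator of the crossing event: nonnegative with
      integral zero.\<close>
    finally have "AE \<omega> in M. ?f \<omega> = 0"
      by (subst (asm) integral_nonneg_eq_0_iff_AE)
        (auto intro!: integrable_const_bound[of _ 1] simp: indicator_def)
    then show ?thesis
      using AE_space by eventually_elim (auto simp: indicator_def split: if_splits)
  qed
  then have "AE \<omega> in M. \<forall>q::rat. \<not> (S (Suc (Suc k)) \<omega> < of_rat q \<and> of_rat q \<le> S (Suc k) \<omega>)"
    by (simp add: AE_all_countable)
  then show ?thesis
  proof eventually_elim
    case (elim \<omega>)
    then show ?case using of_rat_dense[of "S (Suc (Suc k)) \<omega>" "S (Suc k) \<omega>"]
      by (meson less_imp_le not_le)
  qed
qed

lemma (in monotonic_generalized_convolution) renewal_function_eq: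
  assumes rw: "generalized_random_walk (\<diamondop>) \<nu> M S" and \<nu>: "\<nu> \<in> P_plus"
  shows "renewal_function M S t = emeasure (renewal_measure \<nu>) {0..t}"
proof -
  note rwD = generalized_random_walkD[OF rw]
  note [measurable] = rwD(3)
  have "AE \<omega> in M. \<forall>k. S (Suc k) \<omega> \<le> S (Suc (Suc k)) \<omega>"
    by (simp add: AE_all_countable random_walk_mono[OF rw \<nu>])
  then have "renewal_function M S t = (\<integral>\<^sup>+\<omega>. (\<Sum>n. indicator {..t} (S (Suc n) \<omega>)) \<partial>M)"
    unfolding renewal_function_def
    by (intro nn_integral_cong_AE) (auto simp: ennreal_renewal_process)
  \<comment> \<open>Sum and integral are exchanged for nonnegative terms; the walk is nonnegative,
    so \<open>{..t}\<close> may be replaced by \<open>{0..t}\<close>.\<close>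
  also have "\<dots> = (\<Sum>n. \<integral>\<^sup>+\<omega>. indicator {0..t} (S (Suc n) \<omega>) \<partial>M)"
    by (subst nn_integral_suminf)
      (auto intro!: suminf_cong nn_integral_cong simp: indicator_def rwD(4))
  also have "\<dots> = (\<Sum>n. emeasure (distr M borel (S (Suc n))) {0..t})"
  proof (rule suminf_cong)
    fix n
    show "(\<integral>\<^sup>+\<omega>. indicator {0..t} (S (Suc n) \<omega>) \<partial>M) = emeasure (distr M borel (S (Suc n))) {0..t}"
      using nn_integral_distr[OF rwD(3), of "indicator {0..t}" n] by simp
  qed
  finally show ?thesis
    by (simp add: distr_random_walk[OF rw \<nu>] emeasure_renewal_measure \<nu> del: conv_power.simps)
qed

theorem theorem1:
  fixes gc :: "real measure \<Rightarrow> real measure \<Rightarrow> real measure"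
    and \<nu> :: "real measure"
    and M :: "'a measure"
    and S :: "nat \<Rightarrow> 'a \<Rightarrow> real"
  assumes "monotonic_generalized_convolution gc"
    and "\<nu> \<in> P_plus"
    and "generalized_random_walk gc \<nu> M S"
  shows "\<exists>m. half_line_measure m \<and> countable_sum_of_prob m \<and>
    (\<forall>t\<ge>0. emeasure m {0..t} = renewal_function M S t) \<and>
    m = add_measure \<nu> (conv_ext gc \<nu> m)"
proof -
  interpret monotonic_generalized_convolution gc by (rule assms(1))
  show ?thesis
    using assms(2,3)
    by (intro exI[of _ "renewal_measure \<nu>"])
      (simp add: half_line_renewal_measure countable_sum_renewal_measure renewal_function_eq
        flip: renewal_equation)
qed

end
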